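(* For every integer $n\ge 0$, the genus polynomial of the Ringel ladder $RL_n$ is $$\Gamma_{RL_n}(x)\;=\;(1-x)\sum_{j\ge 0}\left(\binom{n-j}{j}+\binom{n-j+1}{j}\right)(8x)^j\;+\;x\,2^{n+1}\sum_{j\ge 0}\left(\binom{n-j}{j}+\binom{n-j+1}{j}\right)(2x)^j .$$
   Context: Binomial coefficients $\binom{m}{j}$ are taken to be $0$ unless $0\le j\le m$ (in particular when $m<0$). Graphs are finite and connected, and multiple edges are allowed. Embeddings are cellular embeddings in closed orientable surfaces. For a graph $G$, $g_i(G)$ denotes the number of combinatorially distinct embeddings of $G$ in the orientable surface $S_i$ of genus $i$; embeddings are counted as rotation systems of $G$ (an assignment to each vertex of a cyclic ordering of the edge-ends at that vertex), so the total number of embeddings is $\prod_v (\deg v-1)!$. The genus polynomial of $G$ is $\Gamma_G(x)=\sum_{i\ge 0} g_i(G)x^i$. Symmetric ladder: for $n\ge 0$, $(\ddot L_n,u,v)$ is the graph obtained from the Cartesian product $P_2\,\Box\,P_{n+2}$ of paths (where $P_m$ is the path on $m$ vertices) by contracting the rung (copy of the edge of $P_2$) at each of the two ends of the ladder (the end edges joining a pair of 2-valent vertices). The two resulting 2-valent vertices at the two ends are the root-vertices $u$ and $v$. (Thus $\ddot L_n$ has $n$ rungs; $\ddot L_0$ is the graph on two vertices $u,v$ joined by two parallel edges.) Ringel ladder: $RL_n$ is the graph obtained from $(\ddot L_n,u,v)$ by adding one new edge joining $u$ to $v$ (this operation is called self-bar-amalgamation). *)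

theory Defs
  imports
    "Graph_Theory.Digraph"
    "HOL-Combinatorics.Permutations"
    "HOL-Combinatorics.Orbits"
    "HOL-Computational_Algebra.Polynomial"
    "HOL-Library.Groups_Big_Fun"
begin

text \<open>
  A finite undirected multigraph is given by a \<^typ>\<open>('a, 'b) pre_digraph\<close> whose arcs are the
  edges of the graph, each listed once with an arbitrary reference orientation.  The notions below
  treat both ends of an edge alike.  The two edge-ends of an edge \<open>e\<close> are \<open>(e, True)\<close>, located
  at the tail of \<open>e\<close>, and \<open>(e, False)\<close>, located at its head; so a loop has two edge-ends at its
  vertex.
\<close>

definition edge_ends :: "('a, 'b) pre_digraph \<Rightarrow> ('b \<times> bool) set" where
  "edge_ends G = arcs G \<times> UNIV"

fun end_vertex :: "('a, 'b) pre_digraph \<Rightarrow> 'b \<times> bool \<Rightarrow> 'a" where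
  "end_vertex G (e, b) = (if b then tail G e else head G e)"

fun opposite_end :: "'b \<times> bool \<Rightarrow> 'b \<times> bool" where
  "opposite_end (e, b) = (e, \<not> b)"

definition edge_ends_at :: "('a, 'b) pre_digraph \<Rightarrow> 'a \<Rightarrow> ('b \<times> bool) set" where
  "edge_ends_at G v = {d \<in> edge_ends G. end_vertex G d = v}"

definition isolated_verts :: "('a, 'b) pre_digraph \<Rightarrow> 'a set" where
  "isolated_verts G = {v \<in> verts G. edge_ends_at G v = {}}"

text \<open>
  A rotation system is encoded as the permutation of all edge-ends that sends each edge-end to the
  next one in the cyclic order at its vertex.  Being the identity off the edge-ends of \<open>G\<close>, it is
  determined by the cyclic orders, so distinct rotation systems are distinct functions.
\<close>

definition rotation_system ::
  "('a, 'b) pre_digraph \<Rightarrow> ('b \<times> bool \<Rightarrow> 'b \<times> bool) \<Rightarrow> bool" where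
  "rotation_system G R \<longleftrightarrow>
     R permutes edge_ends G \<and>
     (\<forall>v \<in> verts G - isolated_verts G. cyclic_on R (edge_ends_at G v))"

text \<open>
  Face tracing: traverse an edge to its opposite end, then take the next edge-end in the rotation.
\<close>

definition faces ::
  "('a, 'b) pre_digraph \<Rightarrow> ('b \<times> bool \<Rightarrow> 'b \<times> bool) \<Rightarrow> ('b \<times> bool) set set" where
  "faces G R = orbit (R \<circ> opposite_end) ` edge_ends G"

text \<open>
  The face of the one-vertex graph without edges has no edge-end on its boundary, whence the last
  summand.
\<close>

definition euler_char ::
  "('a, 'b) pre_digraph \<Rightarrow> ('b \<times> bool \<Rightarrow> 'b \<times> bool) \<Rightarrow> int" where
  "euler_char G R =
     int (card (verts G)) - int (card (arcs G)) +
     (int (card (faces G R)) + int (card (isolated_verts G)))"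

text \<open>
  The closed orientable surface of genus \<open>i\<close> is the one of Euler characteristic \<open>2 - 2 i\<close>.  The
  notions of genus are meant for finite connected graphs.
\<close>

definition num_embeddings :: "('a, 'b) pre_digraph \<Rightarrow> nat \<Rightarrow> nat" where
  "num_embeddings G i = card {R. rotation_system G R \<and> euler_char G R = 2 - 2 * int i}"

definition genus_polynomial :: "('a, 'b) pre_digraph \<Rightarrow> int poly" where
  "genus_polynomial G = Sum_any (\<lambda>i. monom (int (num_embeddings G i)) i)"

definition path_graph :: "nat \<Rightarrow> (nat, nat) pre_digraph" where
  "path_graph m = \<lparr>verts = {..<m}, arcs = {i. Suc i < m}, tail = (\<lambda>i. i), head = Suc\<rparr>"

text \<open>
  The edge \<open>Inl (e, w)\<close> is the copy of the edge \<open>e\<close> of \<open>G\<close> at the vertex \<open>w\<close> of \<open>H\<close>, and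
  \<open>Inr (v, f)\<close> is the copy of the edge \<open>f\<close> of \<open>H\<close> at the vertex \<open>v\<close> of \<open>G\<close>.
\<close>

definition cartesian_product ::
  "('a, 'b) pre_digraph \<Rightarrow> ('c, 'd) pre_digraph \<Rightarrow> ('a \<times> 'c, 'b \<times> 'c + 'a \<times> 'd) pre_digraph" where
  "cartesian_product G H =
     \<lparr>verts = verts G \<times> verts H,
      arcs = (arcs G \<times> verts H) <+> (verts G \<times> arcs H),
      tail = case_sum (\<lambda>(e, w). (tail G e, w)) (\<lambda>(v, f). (v, tail H f)),
      head = case_sum (\<lambda>(e, w). (head G e, w)) (\<lambda>(v, f). (v, head H f))\<rparr>"

text \<open>The vertex resulting from the contraction keeps the name of the tail of the edge.\<close>

definition contract_edge :: "('a, 'b) pre_digraph \<Rightarrow> 'b \<Rightarrow> ('a, 'b) pre_digraph" where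
  "contract_edge G e =
     (let p = (\<lambda>v. if v = head G e then tail G e else v)
      in \<lparr>verts = p ` verts G, arcs = arcs G - {e}, tail = p \<circ> tail G, head = p \<circ> head G\<rparr>)"

text \<open>The new edge is \<open>None\<close>; it is parallel to any edges already joining \<open>u\<close> and \<open>v\<close>.\<close>

definition add_edge :: "('a, 'b) pre_digraph \<Rightarrow> 'a \<Rightarrow> 'a \<Rightarrow> ('a, 'b option) pre_digraph" where
  "add_edge G u v =
     \<lparr>verts = verts G, arcs = insert None (Some ` arcs G),
      tail = case_option u (tail G), head = case_option v (head G)\<rparr>"

text \<open>
  The only edge of \<open>path_graph 2\<close> is \<open>0\<close>, so \<open>Inl (0, k)\<close> is the rung over the \<open>k\<close>-th vertex of
  the long path.
\<close>

definition symmetric_ladder :: "nat \<Rightarrow> (nat \<times> nat, nat \<times> nat + nat \<times> nat) pre_digraph" where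
  "symmetric_ladder n =
     contract_edge
       (contract_edge (cartesian_product (path_graph 2) (path_graph (n + 2))) (Inl (0, 0)))
       (Inl (0, n + 1))"

definition root_u :: "nat \<times> nat" where
  "root_u = (0, 0)"

definition root_v :: "nat \<Rightarrow> nat \<times> nat" where
  "root_v n = (0, n + 1)"

definition ringel_ladder ::
  "nat \<Rightarrow> (nat \<times> nat, (nat \<times> nat + nat \<times> nat) option) pre_digraph" where
  "ringel_ladder n = add_edge (symmetric_ladder n) root_u (root_v n)"

text \<open>
  Binomial coefficients with integer arguments, zero outside \<open>0 \<le> j \<le> m\<close>.  The truncated
  subtraction of \<^typ>\<open>nat\<close> would give, e.g., \<open>(n - j + 1) choose j = 1\<close> for \<open>n = 0\<close>, \<open>j = 1\<close>.
\<close>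

definition binom :: "int \<Rightarrow> int \<Rightarrow> int" where
  "binom m j = (if 0 \<le> j \<and> j \<le> m then int (nat m choose nat j) else 0)"

end

theory Submission
  imports Defs
begin

text \<open>
  The Ringel ladder is cubic, so a rotation system is one choice of sign per vertex.  The faces are
  counted by taking the ladder apart from the end vertex \<open>v\<close>: at every stage the part already
  dismantled is a \<^emph>\<open>cap\<close>, a black box with three ports, to which the top side, the bottom side and
  the edge \<open>uv\<close> are attached.  All that matters about a cap is how face boundaries pass through it,
  that is, a permutation of the three ports.  Initially the cap is the vertex \<open>v\<close> itself and
  the permutation is one of the two 3-cycles.

  The last rung is absorbed into the cap by removing three edges from the graph: removing the two
  sides amounts to contracting them, and the removal of the rung then may cut off one closed face
  (\<open>num_faces_remove_edge\<close>, \<open>remove_rung_faces\<close>).  The new port permutation and the number of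
  closed faces depend only on the old permutation and the signs of the two ends of the rung;
  this is the automaton \<open>add_rung\<close>, and running it through the whole ladder yields the genus
  (\<open>num_faces_capped_ladder\<close>).

  Summing \<open>x\<close> to the genus over all signs turns the automaton into linear recurrences for the
  polynomials \<open>a\<^sub>k\<close> (3-cycles), \<open>b\<^sub>k\<close> (identity), \<open>c\<^sub>k\<close> (transposition of the two sides) and
  \<open>d\<^sub>k\<close> (the other two transpositions) that belong to caps on ladders with \<open>k\<close> rungs:
  \<open>a\<^sub>k\<^sub>+\<^sub>1 = a\<^sub>k + x c\<^sub>k + 2 x d\<^sub>k\<close>, \<open>b\<^sub>k\<^sub>+\<^sub>1 = 4 c\<^sub>k\<close>,
  \<open>c\<^sub>k\<^sub>+\<^sub>1 = 2 c\<^sub>k + 2 x b\<^sub>k\<close>, \<open>d\<^sub>k\<^sub>+\<^sub>1 = 4 a\<^sub>k\<close>.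
  Hence \<open>c\<close> satisfies the second-order recurrence \<open>c\<^sub>k\<^sub>+\<^sub>2 = 2 c\<^sub>k\<^sub>+\<^sub>1 + 8 x c\<^sub>k\<close>, and \<open>a\<close> satisfies
  \<open>a\<^sub>k\<^sub>+\<^sub>2 = a\<^sub>k\<^sub>+\<^sub>1 + 8 x a\<^sub>k + x c\<^sub>k\<^sub>+\<^sub>1\<close>.  With \<open>S\<^sub>k\<^sub>+\<^sub>2(z) = S\<^sub>k\<^sub>+\<^sub>1(z) + z S\<^sub>k(z)\<close>, \<open>S\<^sub>0 = 2\<close>,
  \<open>S\<^sub>1(z) = 2 + z\<close>, the solutions are \<open>c\<^sub>k = 2\<^sup>k S\<^sub>k(2x)\<close> and
  \<open>2 a\<^sub>k = (1 - x) S\<^sub>k(8x) + 2 x c\<^sub>k\<close>.  The genus polynomial is \<open>2 a\<^sub>n\<close>, as \<open>v\<close> has two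
  rotations, and the sums of binomial coefficients in the theorem are the \<open>S\<^sub>n\<close>.
\<close>

section \<open>Counting the cycles of a permutation\<close>

text \<open>
  The first-return map of \<open>f\<close> to the complement of \<open>x\<close>: it short-cuts the cycle through \<open>x\<close>.
\<close>

definition skip :: "'a \<Rightarrow> ('a \<Rightarrow> 'a) \<Rightarrow> 'a \<Rightarrow> 'a" where
  "skip x f = (\<lambda>d. if d = x then x else if f d = x then f x else f d)"

lemma skip_permutes:
  assumes f: "f permutes S" and x: "x \<in> S"
  shows "skip x f permutes (S - {x})"
proof -
  have inj: "inj f" using f by (rule permutes_inj)
  have eq: "skip x f = transpose x (f x) \<circ> f"
    using inj by (auto simp: skip_def transpose_def fun_eq_iff inj_eq)
  have "transpose x (f x) permutes S"
    using f x by (simp add: permutes_swap_id permutes_in_image)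
  with f have "skip x f permutes S" unfolding eq by (rule permutes_compose)
  then show ?thesis
    by (rule permutes_superset) (auto simp: skip_def)
qed

lemma orbit_skip:
  assumes f: "f permutes S" and x: "x \<in> S" and d: "d \<in> S - {x}"
  shows "orbit (skip x f) d = orbit f d - {x}"
proof
  let ?g = "skip x f"
  have "e \<in> orbit f d" if "e \<in> orbit ?g d" for e
    using that
  proof induction
    case base
    then show ?case using d by (auto simp: skip_def intro: orbit.intros)
  next
    case (step e)
    then show ?case by (auto simp: skip_def intro: orbit.intros)
  qed
  moreover have "orbit ?g d \<subseteq> S - {x}"
    using skip_permutes[OF f x] d by (rule permutes_orbit_subset)
  ultimately show "orbit ?g d \<subseteq> orbit f d - {x}" by auto
  have "(e \<noteq> x \<longrightarrow> e \<in> orbit ?g d) \<and> (e = x \<longrightarrow> f x = x \<or> f x \<in> orbit ?g d)"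
    if "e \<in> orbit f d" for e
    using that
  proof induction
    case base
    have "?g d \<in> orbit ?g d" by (rule orbit.base)
    then show ?case using d by (auto simp: skip_def split: if_splits)
  next
    case (step e)
    show ?case
    proof (cases "e = x")
      case True
      with step show ?thesis by auto
    next
      case False
      with step have "?g e \<in> orbit ?g d" by (auto intro: orbit.step)
      with False show ?thesis by (auto simp: skip_def split: if_splits)
    qed
  qed
  then show "orbit f d - {x} \<subseteq> orbit ?g d" by auto
qed

text \<open>
  Deleting a point shortens the cycle through it, and that cycle disappears only if the point was
  fixed.
\<close>

lemma card_orbits_skip:
  assumes f: "f permutes S" and fin: "finite S" and x: "x \<in> S"
  shows "card (orbit f ` S) = card (orbit (skip x f) ` (S - {x})) + (if f x = x then 1 else 0)"
proof -
  let ?g = "skip x f"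
  have perm: "permutation f" using f fin by (auto simp: permutation_permutes)
  have gf: "orbit ?g ` (S - {x}) = (\<lambda>C. C - {x}) ` orbit f ` (S - {x})"
    using orbit_skip[OF f x] by (auto simp: image_iff)
  show ?thesis
  proof (cases "f x = x")
    case True
    have "?g d = f d" for d
    proof (cases "d = x")
      case False
      then have "f d \<noteq> f x" using permutes_inj[OF f] by (simp add: inj_eq)
      then show ?thesis using False by (simp add: skip_def True)
    qed (simp add: skip_def True)
    then have g: "?g = f" ..
    have "orbit f x = {x}" using True by (simp only: orbit_eq_singleton_iff)
    then have "orbit f ` S = insert {x} (orbit f ` (S - {x}))"
      using x by (metis image_insert insert_Diff)
    moreover have "{x} \<notin> orbit ?g ` (S - {x})"
    proof
      assume "{x} \<in> orbit ?g ` (S - {x})"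
      then obtain d where "d \<in> S - {x}" "{x} = orbit ?g d" by blast
      with permutes_orbit_subset[OF skip_permutes[OF f x], of d] show False by blast
    qed
    ultimately show ?thesis using True fin by (simp add: g)
  next
    case False
    have "orbit f ` S = orbit f ` (S - {x})"
    proof -
      have "orbit f x = orbit f (f x)" using permutation_orbit_step[OF perm] by simp
      moreover have "f x \<in> S - {x}" using f x False by (simp add: permutes_in_image)
      ultimately show ?thesis using x by auto
    qed
    moreover have "inj_on (\<lambda>C. C - {x}) (orbit f ` (S - {x}))"
    proof (rule inj_onI)
      fix C C' assume C: "C \<in> orbit f ` (S - {x})" and C': "C' \<in> orbit f ` (S - {x})"
        and eq: "C - {x} = C' - {x}"
      obtain d where d: "d \<in> S - {x}" "C = orbit f d" using C by auto
      have "d \<in> C - {x}" using d permutation_self_in_orbit[OF perm] by auto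
      with eq have "d \<in> C'" by auto
      with C' have "C' = orbit f d"
        using cyclic_on_orbit[OF f fin] orbit_cyclic_eq3 by (metis imageE)
      with d show "C = C'" by simp
    qed
    ultimately show ?thesis using False by (simp add: gf card_image)
  qed
qed

section \<open>Faces under the removal of an edge\<close>

text \<open>
  A permutation of \<open>E \<times> UNIV\<close> composed with \<^const>\<open>opposite_end\<close> moves points outside
  \<open>E \<times> UNIV\<close> as well; the restriction turns the face-tracing map into a permutation of a finite set.
\<close>

definition face_perm :: "'e set \<Rightarrow> ('e \<times> bool \<Rightarrow> 'e \<times> bool) \<Rightarrow> 'e \<times> bool \<Rightarrow> 'e \<times> bool" where
  "face_perm E R = perm_restrict (R \<circ> opposite_end) (E \<times> UNIV)"

definition num_faces :: "'e set \<Rightarrow> ('e \<times> bool \<Rightarrow> 'e \<times> bool) \<Rightarrow> nat" where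
  "num_faces E R = card (orbit (face_perm E R) ` (E \<times> UNIV))"

text \<open>
  The rotation whose face-tracing map is that of \<open>R\<close> with both ends of \<open>e\<close> deleted.  If \<open>e\<close> is
  not a loop, this contracts \<open>e\<close>: the rotations at its two end vertices are spliced together.  If \<open>e\<close>
  is a loop, its vertex is split in two.  The inner conditionals deal with ends of \<open>e\<close> that are
  alone at their vertex.
\<close>

definition remove_edge :: "'e \<Rightarrow> ('e \<times> bool \<Rightarrow> 'e \<times> bool) \<Rightarrow> 'e \<times> bool \<Rightarrow> 'e \<times> bool" where
  "remove_edge e R d =
     (if fst d = e then d
      else if R d = (e, True) then
        (if R (e, False) = (e, False) then R (e, True) else R (e, False))
      else if R d = (e, False) then
        (if R (e, True) = (e, True) then R (e, False) else R (e, True))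
      else R d)"

lemma opposite_end_involution [simp]: "opposite_end (opposite_end d) = d"
  by (cases d) auto

lemma opposite_end_in_iff [simp]: "opposite_end d \<in> E \<times> UNIV \<longleftrightarrow> d \<in> E \<times> UNIV"
  by (cases d) auto

lemma opposite_end_fst [simp]: "fst (opposite_end d) = fst d"
  by (cases d) auto

lemma face_perm_permutes:
  assumes R: "R permutes E \<times> UNIV"
  shows "face_perm E R permutes E \<times> UNIV"
proof -
  have "bij_betw opposite_end (E \<times> UNIV) (E \<times> UNIV)"
    by (rule bij_betw_byWitness[where f' = opposite_end]) auto
  then have "bij_betw (R \<circ> opposite_end) (E \<times> UNIV) (E \<times> UNIV)"
    using permutes_imp_bij[OF R] by (rule bij_betw_trans)
  then have "bij_betw (face_perm E R) (E \<times> UNIV) (E \<times> UNIV)"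
    by (subst bij_betw_cong[of _ _ "R \<circ> opposite_end"])
       (auto simp: face_perm_def perm_restrict_simps)
  then show ?thesis
    by (rule bij_imp_permutes) (simp add: face_perm_def perm_restrict_simps)
qed

lemma num_faces_eq:
  assumes R: "R permutes E \<times> UNIV"
  shows "card (orbit (R \<circ> opposite_end) ` (E \<times> UNIV)) = num_faces E R"
proof -
  have "orbit (R \<circ> opposite_end) d = orbit (face_perm E R) d" if "d \<in> E \<times> UNIV" for d
    using that
    by (rule orbit_cong0)
       (auto simp: face_perm_def perm_restrict_simps permutes_in_image[OF R] Pi_iff
        simp del: mem_Sigma_iff)
  then show ?thesis by (simp add: num_faces_def)
qed

text \<open>
  Removing an edge deletes its two ends from the face-tracing map one after the other.  A face is
  lost exactly when the deleted end is by then the only one on its face.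
\<close>

lemma
  assumes R: "R permutes E \<times> UNIV" and fin: "finite E" and e: "e \<in> E"
  shows remove_edge_permutes: "remove_edge e R permutes (E - {e}) \<times> UNIV"
    and num_faces_remove_edge:
      "num_faces E R = num_faces (E - {e}) (remove_edge e R)
         + (if R (e, False) = (e, True) then 1 else 0)
         + (if R (e, True) = (e, False) \<or> R (e, True) = (e, True) \<and> R (e, False) = (e, False)
            then 1 else 0)"
proof -
  define f where "f = face_perm E R"
  define S where "S = E \<times> (UNIV :: bool set)"
  have f: "f permutes S" unfolding f_def S_def using R by (rule face_perm_permutes)
  have finS: "finite S" using fin by (simp add: S_def)
  have eS: "(e, True) \<in> S" "(e, False) \<in> S - {(e, True)}" using e by (auto simp: S_def)
  let ?f1 = "skip (e, True) f" and ?f2 = "skip (e, False) (skip (e, True) f)"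
  have S2: "S - {(e, True)} - {(e, False)} = (E - {e}) \<times> UNIV"
    by (auto simp: S_def)
  have f1: "?f1 permutes S - {(e, True)}" using f eS(1) by (rule skip_permutes)
  have f2: "?f2 permutes (E - {e}) \<times> UNIV"
    using skip_permutes[OF f1 eS(2)] by (simp add: S2)
  have fe: "f (e, True) = R (e, False)" "f (e, False) = R (e, True)"
    using e by (auto simp: f_def face_perm_def perm_restrict_simps)
  have eq: "?f2 (opposite_end d) = remove_edge e R d" if d: "d \<in> (E - {e}) \<times> UNIV" for d
  proof -
    have ne: "fst d \<noteq> e" "opposite_end d \<noteq> (e, True)" "opposite_end d \<noteq> (e, False)"
      using d opposite_end_fst[of d] by (auto simp del: opposite_end_fst)
    have "opposite_end d \<in> E \<times> UNIV" unfolding opposite_end_in_iff using d by auto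
    then have fd: "f (opposite_end d) = R d"
      by (simp only: f_def face_perm_def perm_restrict_simps o_apply opposite_end_involution)
    have "R (e, True) \<noteq> R d" using permutes_inj[OF R] ne(1) by (auto simp: inj_eq)
    then have "R d = (e, True) \<Longrightarrow> R (e, True) \<noteq> (e, True)" by metis
    then show ?thesis using ne
      by (simp add: skip_def remove_edge_def fe fd)
  qed
  have rem_out: "remove_edge e R d = d" if "d \<notin> (E - {e}) \<times> UNIV" for d
  proof (cases "fst d = e")
    case False
    with that have "R d = d" using permutes_not_in[OF R, of d] by (cases d) auto
    with False show ?thesis by (auto simp: remove_edge_def)
  qed (simp add: remove_edge_def)
  have fp: "face_perm (E - {e}) (remove_edge e R) = ?f2"
  proof
    fix d
    show "face_perm (E - {e}) (remove_edge e R) d = ?f2 d"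
    proof (cases "d \<in> (E - {e}) \<times> UNIV")
      case True
      then have "opposite_end d \<in> (E - {e}) \<times> UNIV" by simp
      from eq[OF this] True show ?thesis
        by (simp only: face_perm_def perm_restrict_simps o_apply opposite_end_involution)
    next
      case False
      with permutes_not_in[OF f2 False] show ?thesis
        by (simp only: face_perm_def perm_restrict_simps(2) not_False_eq_True)
    qed
  qed
  show "remove_edge e R permutes (E - {e}) \<times> UNIV"
  proof (rule bij_imp_permutes[OF _ rem_out])
    have "bij_betw opposite_end ((E - {e}) \<times> UNIV) ((E - {e}) \<times> UNIV)"
      by (rule bij_betw_byWitness[where f' = opposite_end]) auto
    then have "bij_betw (?f2 \<circ> opposite_end) ((E - {e}) \<times> UNIV) ((E - {e}) \<times> UNIV)"
      using permutes_imp_bij[OF f2] by (rule bij_betw_trans)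
    moreover have "remove_edge e R d = (?f2 \<circ> opposite_end) d" if "d \<in> (E - {e}) \<times> UNIV" for d
      using eq[OF that] by simp
    ultimately show "bij_betw (remove_edge e R) ((E - {e}) \<times> UNIV) ((E - {e}) \<times> UNIV)"
      using bij_betw_cong by blast
  qed
  have "num_faces E R = card (orbit f ` S)" by (simp add: num_faces_def f_def S_def)
  also have "\<dots> = card (orbit ?f2 ` ((E - {e}) \<times> UNIV))
      + (if ?f1 (e, False) = (e, False) then 1 else 0) + (if f (e, True) = (e, True) then 1 else 0)"
    using card_orbits_skip[OF f finS eS(1)] card_orbits_skip[OF f1 finite_Diff[OF finS] eS(2)]
    unfolding S2 by linarith
  also have "?f1 (e, False) = (e, False) \<longleftrightarrow>
      R (e, True) = (e, False) \<or> R (e, True) = (e, True) \<and> R (e, False) = (e, False)"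
    by (simp add: skip_def fe)
  finally show "num_faces E R = num_faces (E - {e}) (remove_edge e R)
         + (if R (e, False) = (e, True) then 1 else 0)
         + (if R (e, True) = (e, False) \<or> R (e, True) = (e, True) \<and> R (e, False) = (e, False)
            then 1 else 0)"
    unfolding num_faces_def fp fe by linarith
qed

section \<open>Caps with three ports\<close>

datatype port = Top | Bot | Bar

text \<open>
  The six permutations of the ports: the two 3-cycles, the transpositions named by the port that
  they fix, and the identity.
\<close>

datatype cap = Cyc bool | Fix port | Ident

fun cap_perm :: "cap \<Rightarrow> port \<Rightarrow> port" where
  "cap_perm (Cyc s) Top = (if s then Bot else Bar)"
| "cap_perm (Cyc s) Bot = (if s then Bar else Top)"
| "cap_perm (Cyc s) Bar = (if s then Top else Bot)"
| "cap_perm (Fix Top) p = (case p of Top \<Rightarrow> Top | Bot \<Rightarrow> Bar | Bar \<Rightarrow> Bot)"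
| "cap_perm (Fix Bot) p = (case p of Top \<Rightarrow> Bar | Bot \<Rightarrow> Bot | Bar \<Rightarrow> Top)"
| "cap_perm (Fix Bar) p = (case p of Top \<Rightarrow> Bot | Bot \<Rightarrow> Top | Bar \<Rightarrow> Bar)"
| "cap_perm Ident p = p"

text \<open>
  The cap that arises when a rung with the signs \<open>p\<close> (top end) and \<open>q\<close> (bottom end) is absorbed.
  Contracting the top side replaces the top port in the cycle that contains it by the new top port
  together with the top end of the rung, in the order given by \<open>p\<close>; likewise at the bottom.
  Both ends of the rung are then among the five ends that are permuted, and removing the rung gives
  the values below.
\<close>

fun add_rung :: "cap \<Rightarrow> bool \<Rightarrow> bool \<Rightarrow> cap" where
  "add_rung (Cyc s) p q =
     (if p = q then (if p = s then Fix Top else Fix Bot)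
      else if q = s then Cyc s else Fix Bar)"
| "add_rung (Fix Top) p q = Cyc q"
| "add_rung (Fix Bot) p q = Cyc (\<not> p)"
| "add_rung (Fix Bar) p q = (if p = q then Ident else Fix Bar)"
| "add_rung Ident p q = Fix Bar"

text \<open>
  The least number of transpositions that turn the permutation into a 3-cycle.  This is the
  correction term in Euler's formula for a ladder with a cap, where the 3-cycles are the caps that a
  single vertex could be.
\<close>

fun defect :: "cap \<Rightarrow> nat" where
  "defect (Cyc s) = 0"
| "defect (Fix p) = 1"
| "defect Ident = 2"

text \<open>
  \<open>R\<close> rotates three ends cyclically, in the listed order for the sign \<^const>\<open>True\<close> and in the
  opposite order for \<^const>\<open>False\<close>.
\<close>

definition turns :: "('d \<Rightarrow> 'd) \<Rightarrow> bool \<Rightarrow> 'd \<times> 'd \<times> 'd \<Rightarrow> bool" where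
  "turns R s = (\<lambda>(x, y, z).
     if s then R x = y \<and> R y = z \<and> R z = x else R x = z \<and> R z = y \<and> R y = x)"

fun port_end :: "'d \<times> 'd \<times> 'd \<Rightarrow> port \<Rightarrow> 'd" where
  "port_end (x, y, z) Top = x"
| "port_end (x, y, z) Bot = y"
| "port_end (x, y, z) Bar = z"

lemma range_port_end: "range (port_end (x, y, z)) = {x, y, z}"
proof -
  have "(UNIV :: port set) = {Top, Bot, Bar}" using port.exhaust by auto
  then have "range (port_end (x, y, z)) = port_end (x, y, z) ` {Top, Bot, Bar}" by (rule arg_cong)
  then show ?thesis by simp
qed

definition capped :: "('d \<Rightarrow> 'd) \<Rightarrow> cap \<Rightarrow> 'd \<times> 'd \<times> 'd \<Rightarrow> bool" where
  "capped R \<beta> t \<longleftrightarrow> (\<forall>p. R (port_end t p) = port_end t (cap_perm \<beta> p))"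

lemma all_ports: "(\<forall>p. P p) \<longleftrightarrow> P Top \<and> P Bot \<and> P Bar"
proof
  assume "P Top \<and> P Bot \<and> P Bar"
  then have "P p" for p by (cases p) auto
  then show "\<forall>p. P p" ..
qed simp

lemma capped_alt:
  "capped R \<beta> (x, y, z) \<longleftrightarrow> R x = port_end (x, y, z) (cap_perm \<beta> Top)
     \<and> R y = port_end (x, y, z) (cap_perm \<beta> Bot) \<and> R z = port_end (x, y, z) (cap_perm \<beta> Bar)"
  by (simp add: capped_def all_ports)

lemma cap_cases: 
  obtains "\<beta> = Cyc True" | "\<beta> = Cyc False" | "\<beta> = Fix Top" | "\<beta> = Fix Bot" | "\<beta> = Fix Bar"
    | "\<beta> = Ident"
proof (cases \<beta>)
  case (Cyc s)
  then show thesis using that by (cases s) auto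
next
  case (Fix p)
  then show thesis using that by (cases p) auto
qed (use that in blast)

text \<open>
  A cap with ports at the far ends of the sides \<open>a\<close> and \<open>b\<close> swallows these sides and the rung \<open>r\<close>
  between their near ends; \<open>x\<close> and \<open>y\<close> are the ends that precede the two sides along the ladder.
  A face is cut off exactly when the port permutation does not change.
\<close>

lemma
  assumes R: "R permutes E \<times> UNIV" and fin: "finite E"
    and abr: "a \<in> E" "b \<in> E" "r \<in> E" "a \<noteq> b" "a \<noteq> r" "b \<noteq> r"
    and xyz: "x \<noteq> y" "x \<noteq> z" "y \<noteq> z" "{fst x, fst y, fst z} \<inter> {a, b, r} = {}"
    and p: "turns R p (x, (a, True), (r, True))"
    and q: "turns R q (y, (b, True), (r, False))"
    and cap: "capped R \<beta> ((a, False), (b, False), z)"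
    and R': "R' = remove_edge r (remove_edge b (remove_edge a R))"
  shows remove_rung_permutes: "R' permutes (E - {a, b, r}) \<times> UNIV"
    and remove_rung_faces: "num_faces E R =
      num_faces (E - {a, b, r}) R' + (if add_rung \<beta> p q = \<beta> then 1 else 0)"
    and remove_rung_cap: "capped R' (add_rung \<beta> p q) (x, y, z)"
    and remove_rung_other:
      "\<And>d. fst d \<notin> {a, b, r} \<Longrightarrow> d \<notin> {x, y, z} \<Longrightarrow> R' d = R d"
proof -
  let ?N = "{x, y, z, (a, True), (a, False), (b, True), (b, False), (r, True), (r, False)}"
  have E3: "E - {a} - {b} - {r} = E - {a, b, r}" by auto
  let ?R1 = "remove_edge a R" and ?R2 = "remove_edge b (remove_edge a R)"
  note P1 = remove_edge_permutes[OF R fin abr(1)]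
  have P2: "?R2 permutes (E - {a} - {b}) \<times> UNIV"
    using remove_edge_permutes[OF P1, of b] fin abr by auto
  have P3: "R' permutes (E - {a} - {b} - {r}) \<times> UNIV"
    using remove_edge_permutes[OF P2, of r] fin abr by (auto simp: R')
  then show "R' permutes (E - {a, b, r}) \<times> UNIV" unfolding E3 .
  have f: "num_faces E R = num_faces (E - {a}) ?R1
         + (if R (a, False) = (a, True) then 1 else 0)
         + (if R (a, True) = (a, False) \<or> R (a, True) = (a, True) \<and> R (a, False) = (a, False)
            then 1 else 0)"
      "num_faces (E - {a}) ?R1 = num_faces (E - {a} - {b}) ?R2
         + (if ?R1 (b, False) = (b, True) then 1 else 0)
         + (if ?R1 (b, True) = (b, False) \<or> ?R1 (b, True) = (b, True) \<and> ?R1 (b, False) = (b, False)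
            then 1 else 0)"
      "num_faces (E - {a} - {b}) ?R2 = num_faces (E - {a, b, r}) R'
         + (if ?R2 (r, False) = (r, True) then 1 else 0)
         + (if ?R2 (r, True) = (r, False) \<or> ?R2 (r, True) = (r, True) \<and> ?R2 (r, False) = (r, False)
            then 1 else 0)"
    using num_faces_remove_edge[OF R fin abr(1)]
      num_faces_remove_edge[OF P1, of b] num_faces_remove_edge[OF P2, of r] fin abr
    by (simp_all add: R' E3)
  have ne: "fst x \<noteq> a" "fst x \<noteq> b" "fst x \<noteq> r" "fst y \<noteq> a" "fst y \<noteq> b" "fst y \<noteq> r"
      "fst z \<noteq> a" "fst z \<noteq> b" "fst z \<noteq> r"
    using xyz(4) by auto
  then have ne': "x \<noteq> (a, s)" "x \<noteq> (b, s)" "x \<noteq> (r, s)" "y \<noteq> (a, s)" "y \<noteq> (b, s)" "y \<noteq> (r, s)"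
      "z \<noteq> (a, s)" "z \<noteq> (b, s)" "z \<noteq> (r, s)" for s
    by auto
  note neq = ne ne' ne'[symmetric] abr(4-6) abr(4-6)[symmetric] xyz(1-3) xyz(1-3)[symmetric]
  have main: "num_faces E R =
      num_faces (E - {a, b, r}) R' + (if add_rung \<beta> p q = \<beta> then 1 else 0)
     \<and> capped R' (add_rung \<beta> p q) (x, y, z)"
    unfolding f capped_alt R'
    by (cases \<beta> rule: cap_cases; cases p; cases q;
        insert p q cap; simp add: turns_def capped_alt remove_edge_def neq)
  \<comment> \<open>These nine ends are permuted among themselves, so no other end is mapped to a removed one.\<close>
  have "R ` ?N \<subseteq> ?N"
    by (cases \<beta> rule: cap_cases; cases p; cases q;
        insert p q cap; simp add: turns_def capped_alt)
  then have N: "R ` ?N = ?N"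
    by (rule endo_inj_surj[OF _ _ inj_on_subset[OF permutes_inj[OF R] subset_UNIV], rotated]) blast
  from main show "num_faces E R =
      num_faces (E - {a, b, r}) R' + (if add_rung \<beta> p q = \<beta> then 1 else 0)"
    and "capped R' (add_rung \<beta> p q) (x, y, z)" by auto
  fix d assume d: "fst d \<notin> {a, b, r}" "d \<notin> {x, y, z}"
  then have "d \<notin> ?N" by auto
  then have "R d \<notin> R ` ?N" unfolding inj_image_mem_iff[OF permutes_inj[OF R]] .
  then have "R d \<notin> ?N" unfolding N .
  then show "R' d = R d" using d by (simp add: R' remove_edge_def)
qed

text \<open>
  When all rungs are absorbed, the three ports are joined to the one vertex that is left, and there are
  three faces, less the defect, unless the cap is a 3-cycle that turns the same way as
  the vertex: then there is a single face, on the torus.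
\<close>

lemma num_faces_triple_edge:
  assumes R: "R permutes {a, b, c} \<times> UNIV"
    and abc: "a \<noteq> b" "a \<noteq> c" "b \<noteq> c"
    and p: "turns R p ((a, True), (b, True), (c, True))"
    and cap: "capped R \<beta> ((a, False), (b, False), (c, False))"
  shows "num_faces {a, b, c} R + 2 * (if \<beta> = Cyc p then 1 else 0) + defect \<beta> = 3"
proof -
  let ?R1 = "remove_edge a R" and ?R2 = "remove_edge b (remove_edge a R)"
  have D: "{a, b, c} - {a} = {b, c}" "{b, c} - {b} = {c}" using abc by auto
  have P1: "?R1 permutes {b, c} \<times> UNIV"
    using remove_edge_permutes[OF R, of a] by (simp add: D)
  have P2: "?R2 permutes {c} \<times> UNIV"
    using remove_edge_permutes[OF P1, of b] by (simp add: D)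
  have "num_faces {a, b, c} R = num_faces {} (remove_edge c ?R2)
         + (if R (a, False) = (a, True) then 1 else 0)
         + (if R (a, True) = (a, False) \<or> R (a, True) = (a, True) \<and> R (a, False) = (a, False)
            then 1 else 0)
         + (if ?R1 (b, False) = (b, True) then 1 else 0)
         + (if ?R1 (b, True) = (b, False) \<or> ?R1 (b, True) = (b, True) \<and> ?R1 (b, False) = (b, False)
            then 1 else 0)
         + (if ?R2 (c, False) = (c, True) then 1 else 0)
         + (if ?R2 (c, True) = (c, False) \<or> ?R2 (c, True) = (c, True) \<and> ?R2 (c, False) = (c, False)
            then 1 else 0)"
    using num_faces_remove_edge[OF R, of a]
      num_faces_remove_edge[OF P1, of b] num_faces_remove_edge[OF P2, of c]
    by (simp add: D)
  also have "num_faces {} (remove_edge c ?R2) = 0" by (simp add: num_faces_def)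
  finally show ?thesis
    by (cases \<beta> rule: cap_cases; cases p; insert p cap;
        simp add: turns_def capped_alt remove_edge_def abc abc[symmetric])
qed

section \<open>Ladders closed by a cap\<close>

type_synonym ladder_edge = "(nat \<times> nat + nat \<times> nat) option"

abbreviation bar :: ladder_edge where "bar \<equiv> None"
abbreviation rung :: "nat \<Rightarrow> ladder_edge" where "rung j \<equiv> Some (Inl (0, j))"
abbreviation side :: "nat \<Rightarrow> nat \<Rightarrow> ladder_edge" where "side i j \<equiv> Some (Inr (i, j))"

definition ladder_edges :: "nat \<Rightarrow> ladder_edge set" where
  "ladder_edges k = insert bar (rung ` {1..k} \<union> side 0 ` {..k} \<union> side 1 ` {..k})"

text \<open>
  In a ladder with \<open>k\<close> rungs that is closed by a cap, the cap takes the place of the end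
  vertex; \<open>ladder_verts\<close> contains the other vertices only.
\<close>

definition ladder_verts :: "nat \<Rightarrow> (nat \<times> nat) set" where
  "ladder_verts k = insert (0, 0) ({0, 1} \<times> {1..k})"

text \<open>
  The three ends at a vertex, in the order that serves as the positive rotation.  A rung has its tail
  on the top side, the side of index \<open>0\<close>.
\<close>

fun corner :: "nat \<times> nat \<Rightarrow>
    (ladder_edge \<times> bool) \<times> (ladder_edge \<times> bool) \<times> (ladder_edge \<times> bool)" where
  "corner (i, 0) = ((side 0 0, True), (side 1 0, True), (bar, True))"
| "corner (i, Suc j) = ((side i j, False), (side i (Suc j), True), (rung (Suc j), i = 0))"

definition cap_ends :: "nat \<Rightarrow>
    (ladder_edge \<times> bool) \<times> (ladder_edge \<times> bool) \<times> (ladder_edge \<times> bool)" where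
  "cap_ends k = ((side 0 k, False), (side 1 k, False), (bar, False))"

text \<open>
  \<open>A\<close> is the set of vertices with positive rotation.
\<close>

definition capped_ladder ::
  "nat \<Rightarrow> (nat \<times> nat) set \<Rightarrow> cap \<Rightarrow> (ladder_edge \<times> bool \<Rightarrow> ladder_edge \<times> bool) \<Rightarrow> bool" where
  "capped_ladder k A \<beta> R \<longleftrightarrow> R permutes ladder_edges k \<times> UNIV
     \<and> (\<forall>v \<in> ladder_verts k. turns R (v \<in> A) (corner v)) \<and> capped R \<beta> (cap_ends k)"

text \<open>
  A handle arises whenever the absorption of a rung increases the defect of the cap, and possibly
  when the cap meets the last vertex.
\<close>

fun ladder_genus :: "(nat \<times> nat) set \<Rightarrow> cap \<Rightarrow> nat \<Rightarrow> nat" where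
  "ladder_genus A \<beta> 0 = (if \<beta> = Cyc ((0, 0) \<in> A) then 1 else 0)"
| "ladder_genus A \<beta> (Suc k) =
     (let \<beta>' = add_rung \<beta> ((0, Suc k) \<in> A) ((1, Suc k) \<in> A)
      in (if defect \<beta> < defect \<beta>' then 1 else 0) + ladder_genus A \<beta>' k)"

text \<open>
  The absorption of a rung removes two vertices and three edges.  In Euler's formula this is
  balanced by a closed face, by a change of the defect, or by a change of the defect and a handle.
\<close>

lemma defect_add_rung:
  "(if add_rung \<beta> p q = \<beta> then 1 else 0) + 2 * (if defect \<beta> < defect (add_rung \<beta> p q) then 1 else 0)
     + defect \<beta> = defect (add_rung \<beta> p q) + 1"
  by (cases \<beta> rule: cap_cases) auto

lemma finite_ladder_edges [simp]: "finite (ladder_edges k)"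
  by (simp add: ladder_edges_def)

lemma ladder_edges_Suc:
  "ladder_edges k = ladder_edges (Suc k) - {side 0 (Suc k), side 1 (Suc k), rung (Suc k)}"
  by (auto simp: ladder_edges_def image_iff)

lemma ladder_verts_Suc:
  "ladder_verts (Suc k) = insert (0, Suc k) (insert (1, Suc k) (ladder_verts k))"
  by (auto simp: ladder_verts_def)

lemma turns_cong:
  assumes "turns R s t" and "\<And>p. R' (port_end t p) = R (port_end t p)"
  shows "turns R' s t"
proof -
  obtain x y z where t: "t = (x, y, z)" by (cases t)
  then show ?thesis
    using assms(1) assms(2)[of Top] assms(2)[of Bot] assms(2)[of Bar] by (simp add: turns_def)
qed

text \<open>
  Euler's formula for a ladder with a cap, by absorbing the rungs one at a time until only the vertex
  \<open>(0, 0)\<close> is left.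
\<close>

lemma num_faces_capped_ladder:
  assumes "capped_ladder k A \<beta> R"
  shows "num_faces (ladder_edges k) R + 2 * ladder_genus A \<beta> k + defect \<beta> = k + 3"
  using assms
proof (induction k arbitrary: \<beta> R)
  case 0
  have E: "ladder_edges 0 = {side 0 0, side 1 0, bar}" by (auto simp: ladder_edges_def)
  show ?case
    using 0 num_faces_triple_edge[of R "side 0 0" "side 1 0" bar "(0, 0) \<in> A" \<beta>]
    by (simp add: capped_ladder_def E ladder_verts_def cap_ends_def)
next
  case (Suc k)
  let ?p = "(0, Suc k) \<in> A" and ?q = "(1, Suc k) \<in> A"
  let ?a = "side 0 (Suc k)" and ?b = "side 1 (Suc k)" and ?r = "rung (Suc k)"
  define R' where "R' = remove_edge ?r (remove_edge ?b (remove_edge ?a R))"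
  have R: "R permutes ladder_edges (Suc k) \<times> UNIV"
    and cap: "capped R \<beta> (cap_ends (Suc k))"
    using Suc.prems by (auto simp: capped_ladder_def)
  have turns: "turns R (v \<in> A) (corner v)" if "v \<in> ladder_verts (Suc k)" for v
    using Suc.prems that by (auto simp: capped_ladder_def)
  have E: "?a \<in> ladder_edges (Suc k)" "?b \<in> ladder_edges (Suc k)" "?r \<in> ladder_edges (Suc k)"
    by (auto simp: ladder_edges_def)
  have p: "turns R ?p ((side 0 k, False), (?a, True), (?r, True))"
    using turns[of "(0, Suc k)"] by (simp add: ladder_verts_Suc)
  have q: "turns R ?q ((side 1 k, False), (?b, True), (?r, False))"
    using turns[of "(1, Suc k)"] by (simp add: ladder_verts_Suc)
  note remove = R finite_ladder_edges E _ _ _ _ _ _ _ p q cap[unfolded cap_ends_def] R'_def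
  have "R' permutes ladder_edges k \<times> UNIV"
    unfolding ladder_edges_Suc[of k] by (rule remove_rung_permutes[OF remove]) auto
  moreover have "capped R' (add_rung \<beta> ?p ?q) (cap_ends k)"
    unfolding cap_ends_def by (rule remove_rung_cap[OF remove]) auto
  moreover have "turns R' (v \<in> A) (corner v)" if v: "v \<in> ladder_verts k" for v
  proof (rule turns_cong)
    show "turns R (v \<in> A) (corner v)" using turns v by (simp add: ladder_verts_Suc)
    fix p
    show "R' (port_end (corner v) p) = R (port_end (corner v) p)"
      by (rule remove_rung_other[OF remove])
        (use v in \<open>cases v rule: corner.cases; cases p; auto simp: ladder_verts_def\<close>)+
  qed
  ultimately have "capped_ladder k A (add_rung \<beta> ?p ?q) R'"
    by (simp add: capped_ladder_def)
  from Suc.IH[OF this]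
  have "num_faces (ladder_edges k) R' + 2 * ladder_genus A (add_rung \<beta> ?p ?q) k
    + defect (add_rung \<beta> ?p ?q) = k + 3" .
  moreover have "num_faces (ladder_edges (Suc k)) R =
      num_faces (ladder_edges k) R' + (if add_rung \<beta> ?p ?q = \<beta> then 1 else 0)"
    unfolding ladder_edges_Suc[of k] by (rule remove_rung_faces[OF remove]) auto
  ultimately show ?case
    using defect_add_rung[of \<beta> ?p ?q] by (simp add: Let_def)
qed

section \<open>Rotation systems of cubic graphs\<close>

text \<open>
  The rotation of three given ends as a function, to build rotation systems from signs.
\<close>

fun turn :: "bool \<Rightarrow> 'd \<times> 'd \<times> 'd \<Rightarrow> 'd \<Rightarrow> 'd" where
  "turn s (x, y, z) d = (if d = x then (if s then y else z)
     else if d = y then (if s then z else x) else (if s then x else y))"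

text \<open>
  Three ends have just two cyclic orders: a map without fixed points and without 2-cycles on
  three points is a 3-cycle.
\<close>

lemma cyclic_on_triple_iff:
  assumes ne: "x \<noteq> y" "x \<noteq> z" "y \<noteq> z"
  shows "cyclic_on R {x, y, z} \<longleftrightarrow> (\<exists>s. turns R s (x, y, z))"
proof
  assume c: "cyclic_on R {x, y, z}"
  have orb: "orbit R d = {x, y, z}" if "d \<in> {x, y, z}" for d
    using c that by (rule orbit_cyclic_eq3)
  have in3: "R d \<in> {x, y, z}" if "d \<in> {x, y, z}" for d
    using c that by (rule cyclic_on_inI)
  have nofix: "R d \<noteq> d" if "d \<in> {x, y, z}" for d
  proof
    assume "R d = d"
    then have "orbit R d = {d}" by (simp only: orbit_eq_singleton_iff)
    with orb[OF that] ne show False by auto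
  qed
  have no2: False if d: "d \<in> {x, y, z}" "R d = e" "R e = d" for d e
  proof -
    have "a \<in> {d, e}" if "a \<in> orbit R d" for a
      using that by induction (use d(2,3) in auto)
    then have "orbit R d \<subseteq> {d, e}" by (rule subsetI)
    then have "card {x, y, z} \<le> card {d, e}" unfolding orb[OF d(1)] by (intro card_mono) simp_all
    also have "card {d, e} \<le> 2" by (simp add: card_insert_if)
    finally show False using ne by simp
  qed
  have "R x = y \<or> R x = z" "R y = x \<or> R y = z" "R z = x \<or> R z = y"
    using in3[of x] nofix[of x] in3[of y] nofix[of y] in3[of z] nofix[of z] by simp_all
  moreover have "\<not> (R x = y \<and> R y = x)" "\<not> (R x = z \<and> R z = x)" "\<not> (R y = z \<and> R z = y)"
    using no2 by blast+
  ultimately show "\<exists>s. turns R s (x, y, z)"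
    by (simp add: turns_def ex_bool_eq) blast
next
  assume "\<exists>s. turns R s (x, y, z)"
  then obtain s where s: "turns R s (x, y, z)" ..
  have "a \<in> {x, y, z}" if "a \<in> orbit R x" for a
    using that by induction (use s in \<open>cases s; auto simp: turns_def\<close>)+
  moreover have "R x \<in> orbit R x" "R (R x) \<in> orbit R x" "R (R (R x)) \<in> orbit R x"
    by (simp_all add: orbit.intros)
  then have "{x, y, z} \<subseteq> orbit R x"
    using s by (cases s) (simp_all add: turns_def)
  ultimately have "orbit R x = {x, y, z}" by blast
  then show "cyclic_on R {x, y, z}" by (intro cyclic_on_singleI[of x]) auto
qed

lemma turns_own_sign: "\<exists>s. turns R s t \<Longrightarrow> turns R (turns R True t) t"
proof (cases "turns R True t")
  case False
  assume "\<exists>s. turns R s t"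
  then obtain s where s: "turns R s t" ..
  with False have "\<not> s" by (cases s) auto
  with s False show ?thesis by simp
qed simp

text \<open>
  As three ends have two cyclic orders, the positive one among them can be chosen at each vertex
  independently of the other vertices, and these choices fix the rotation system.
\<close>

lemma
  fixes G :: "('a, 'b) pre_digraph"
    and ends :: "'a \<Rightarrow> ('b \<times> bool) \<times> ('b \<times> bool) \<times> ('b \<times> bool)"
  assumes ends: "\<And>v. v \<in> verts G \<Longrightarrow> edge_ends_at G v = range (port_end (ends v))"
    and dist: "\<And>v. v \<in> verts G \<Longrightarrow> inj (port_end (ends v))"
    and wf: "\<And>d. d \<in> edge_ends G \<Longrightarrow> end_vertex G d \<in> verts G"
  shows rotation_system_cubic_iff: "\<And>R. rotation_system G R \<longleftrightarrow>
      R permutes edge_ends G \<and> (\<forall>v \<in> verts G. \<exists>s. turns R s (ends v))"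
    and bij_betw_cubic_rotation_systems:
      "bij_betw (\<lambda>R. {v \<in> verts G. turns R True (ends v)})
        {R. rotation_system G R} (Pow (verts G))"
proof -
  have triple: "\<exists>x y z. ends v = (x, y, z) \<and> x \<noteq> y \<and> x \<noteq> z \<and> y \<noteq> z \<and> edge_ends_at G v = {x, y, z}"
    if v: "v \<in> verts G" for v
  proof -
    obtain x y z where t: "ends v = (x, y, z)" by (cases "ends v")
    have "x \<noteq> y \<and> x \<noteq> z \<and> y \<noteq> z"
      using dist[OF v] injD[of "port_end (x, y, z)" Top Bot] injD[of "port_end (x, y, z)" Top Bar]
        injD[of "port_end (x, y, z)" Bot Bar] by (auto simp: t)
    then show ?thesis using ends[OF v] t by (auto simp: range_port_end)
  qed
  have at: "d \<in> edge_ends_at G v \<longleftrightarrow> d \<in> edge_ends G \<and> end_vertex G d = v" for d v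
    by (auto simp: edge_ends_at_def)
  have iso: "isolated_verts G = {}" using triple by (fastforce simp: isolated_verts_def)
  have cyc: "cyclic_on R (edge_ends_at G v) \<longleftrightarrow> (\<exists>s. turns R s (ends v))" if "v \<in> verts G" for R v
    using triple[OF that] cyclic_on_triple_iff by metis
  show rs: "rotation_system G R \<longleftrightarrow>
      R permutes edge_ends G \<and> (\<forall>v \<in> verts G. \<exists>s. turns R s (ends v))" for R
    using cyc by (auto simp: rotation_system_def iso)
  let ?f = "\<lambda>R. {v \<in> verts G. turns R True (ends v)}"
  show "bij_betw ?f {R. rotation_system G R} (Pow (verts G))"
  proof (rule bij_betwI')
    fix R R' assume "R \<in> {R. rotation_system G R}" "R' \<in> {R. rotation_system G R}"
    then have R: "rotation_system G R" "rotation_system G R'" by auto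
    have "R = R'" if eq: "?f R = ?f R'"
    proof
      fix d
      show "R d = R' d"
      proof (cases "d \<in> edge_ends G")
        case False
        then show ?thesis
          using R rs permutes_not_in[of R "edge_ends G" d] permutes_not_in[of R' "edge_ends G" d]
          by simp
      next
        case True
        define v where "v = end_vertex G d"
        have v: "v \<in> verts G" "d \<in> edge_ends_at G v" using True wf by (auto simp: v_def at)
        obtain x y z where t: "ends v = (x, y, z)" "x \<noteq> y" "x \<noteq> z" "y \<noteq> z"
          "edge_ends_at G v = {x, y, z}"
          using triple[OF v(1)] by blast
        have d: "d \<in> {x, y, z}" using v(2) t(5) by simp
        have "turns R True (ends v) \<longleftrightarrow> turns R' True (ends v)" using eq v(1) by blast
        then have "turns R' (turns R True (ends v)) (ends v)"
          using R(2) v(1) rs turns_own_sign[of R'] by simp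
        moreover have "turns R (turns R True (ends v)) (ends v)"
          using R(1) v(1) rs turns_own_sign[of R] by simp
        ultimately obtain s where "turns R s (ends v)" "turns R' s (ends v)" by blast
        then show ?thesis using t(2-4) d unfolding t(1) turns_def prod.case
          by (cases s) auto
      qed
    qed
    then show "?f R = ?f R' \<longleftrightarrow> R = R'" by auto
  next
    fix A assume "A \<in> Pow (verts G)"
    then have A: "A \<subseteq> verts G" by simp
    define rot where "rot = (\<lambda>A d. if d \<in> edge_ends G
      then turn (end_vertex G d \<in> A) (ends (end_vertex G d)) d else d)"
    have rot_at: "rot B d = turn (v \<in> B) (ends v) d \<and> rot B d \<in> edge_ends_at G v"
      if v: "v \<in> verts G" and d: "d \<in> edge_ends_at G v" for B d v
    proof -
      obtain x y z where t: "ends v = (x, y, z)" "x \<noteq> y" "x \<noteq> z" "y \<noteq> z"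
        "edge_ends_at G v = {x, y, z}" using triple[OF v] by blast
      have "rot B d = turn (v \<in> B) (ends v) d" using d by (simp add: rot_def at)
      moreover have "turn (v \<in> B) (ends v) d \<in> edge_ends_at G v" by (simp add: t)
      ultimately show ?thesis by simp
    qed
    have rot_in: "rot B d \<in> edge_ends G" if "d \<in> edge_ends G" for B d
    proof -
      have "d \<in> edge_ends_at G (end_vertex G d)" using that by (simp add: at)
      from conjunct2[OF rot_at[OF wf[OF that] this]] show ?thesis by (simp only: at)
    qed
    \<comment> \<open>Reversing all signs inverts the rotation, which gives bijectivity.\<close>
    have inv: "rot B (rot C d) = d" if d: "d \<in> edge_ends G" and BC: "B = - C" for B C d
    proof -
      define v where "v = end_vertex G d"
      have v: "v \<in> verts G" "d \<in> edge_ends_at G v" using d wf by (auto simp: v_def at)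
      have "rot B (rot C d) = turn (v \<in> B) (ends v) (turn (v \<in> C) (ends v) d)"
        using conjunct1[OF rot_at[OF v, of C]]
          conjunct1[OF rot_at[OF v(1) conjunct2[OF rot_at[OF v, of C]], of B]] by (simp only:)
      moreover obtain x y z where t: "ends v = (x, y, z)" "x \<noteq> y" "x \<noteq> z" "y \<noteq> z"
        "edge_ends_at G v = {x, y, z}" using triple[OF v(1)] by blast
      moreover have "d \<in> {x, y, z}" using v(2) t(5) by simp
      ultimately show ?thesis using BC by (cases "v \<in> C") auto
    qed
    have "rot A permutes edge_ends G"
    proof (rule bij_imp_permutes)
      show "bij_betw (rot A) (edge_ends G) (edge_ends G)"
        by (rule bij_betw_byWitness[where f' = "rot (- A)"]) (simp_all add: inv rot_in image_subset_iff)
    qed (simp add: rot_def)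
    moreover have turns: "turns (rot A) s (ends v) \<longleftrightarrow> s = (v \<in> A)" if v: "v \<in> verts G" for s v
    proof -
      obtain x y z where t: "ends v = (x, y, z)" "x \<noteq> y" "x \<noteq> z" "y \<noteq> z"
        "edge_ends_at G v = {x, y, z}" using triple[OF v] by blast
      then show ?thesis
        using conjunct1[OF rot_at[OF v, of x A]] conjunct1[OF rot_at[OF v, of y A]]
          conjunct1[OF rot_at[OF v, of z A]]
        by (cases s; cases "v \<in> A") (simp_all add: turns_def)
    qed
    ultimately have "rotation_system G (rot A)" by (simp add: rs)
    moreover have "A = ?f (rot A)" using A turns by auto
    ultimately show "\<exists>R \<in> {R. rotation_system G R}. A = ?f R" by blast
  qed auto
qed

section \<open>The Ringel ladder\<close>

lemma arcs_ringel_ladder: "arcs (ringel_ladder n) = ladder_edges n"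
proof -
  have "arcs (ringel_ladder n) = insert None (Some `
      ((({0} \<times> {..Suc n}) <+> ({0, 1} \<times> {..n})) - {Inl (0, 0), Inl (0, Suc n)}))"
    by (auto simp: ringel_ladder_def add_edge_def symmetric_ladder_def contract_edge_def
      cartesian_product_def path_graph_def Let_def less_2_cases_iff)
  also have "(({0} \<times> {..Suc n}) <+> ({0, 1} \<times> {..n})) - {Inl (0, 0), Inl (0, Suc n)}
      = (\<lambda>j. Inl (0, j)) ` {1..n} \<union> (\<lambda>j. Inr (0, j)) ` {..n} \<union> (\<lambda>j. Inr (1, j)) ` {..n}"
    by (auto simp: image_iff Plus_def)
  finally show ?thesis by (simp only: ladder_edges_def image_Un image_image)
qed

lemma verts_ringel_ladder: "verts (ringel_ladder n) = insert (0, Suc n) (ladder_verts n)"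
proof -
  let ?p = "\<lambda>v. if v = (1, 0) then (0, 0) else v"
  let ?q = "\<lambda>v. if v = (1, Suc n) then (0, Suc n) else v"
  have "verts (ringel_ladder n) = ?q ` ?p ` ({0, 1} \<times> {..<n + 2})"
    by (simp add: ringel_ladder_def add_edge_def symmetric_ladder_def contract_edge_def
      cartesian_product_def path_graph_def Let_def lessThan_nat_numeral lessThan_Suc numeral_2_eq_2
      insert_commute)
  also have "\<dots> = insert (0, Suc n) (ladder_verts n)" (is "?L = ?R")
  proof
    show "?L \<subseteq> ?R"
      by (auto simp: ladder_verts_def)
    have "v \<in> ?L" if "v \<in> ?R" for v
    proof -
      have "?q (?p v) = v" "v \<in> {0, 1} \<times> {..<n + 2}" using that by (auto simp: ladder_verts_def)
      then show ?thesis by (intro image_eqI[of _ ?q "?p v"] image_eqI[of _ ?p v]) (simp_all only:)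
    qed
    then show "?R \<subseteq> ?L" by blast
  qed
  finally show ?thesis .
qed

text \<open>
  The end vertex \<open>(0, Suc n)\<close> is the initial cap, so its reference order lists the ports.
\<close>

definition ringel_ends :: "nat \<Rightarrow> nat \<times> nat \<Rightarrow>
    (ladder_edge \<times> bool) \<times> (ladder_edge \<times> bool) \<times> (ladder_edge \<times> bool)" where
  "ringel_ends n v = (if v = (0, Suc n) then cap_ends n else corner v)"

lemma end_vertex_ringel_ladder:
  "end_vertex (ringel_ladder n) (bar, b) = (if b then (0, 0) else (0, Suc n))"
  "j \<in> {1..n} \<Longrightarrow> end_vertex (ringel_ladder n) (rung j, b) = (if b then 0 else 1, j)"
  "i < 2 \<Longrightarrow> j \<le> n \<Longrightarrow> end_vertex (ringel_ladder n) (side i j, b) =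
     (if b then (if j = 0 then 0 else i, j) else (if j = n then 0 else i, Suc j))"
  by (auto simp: ringel_ladder_def add_edge_def symmetric_ladder_def contract_edge_def
      cartesian_product_def path_graph_def Let_def root_u_def root_v_def less_2_cases_iff)


declare end_vertex.simps [simp del]

lemma edge_ends_ringel_ladder_cases:
  assumes "d \<in> edge_ends (ringel_ladder n)"
  obtains b where "d = (bar, b)"
    | j b where "d = (rung j, b)" "j \<in> {1..n}"
    | i j b where "d = (side i j, b)" "i < 2" "j \<le> n"
  using assms by (cases d) (auto simp: edge_ends_def arcs_ringel_ladder ladder_edges_def)

lemma ladder_edges_iff [simp]:
  "bar \<in> ladder_edges n"
  "rung j \<in> ladder_edges n \<longleftrightarrow> j \<in> {1..n}"
  "side i j \<in> ladder_edges n \<longleftrightarrow> i < 2 \<and> j \<le> n"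
  by (auto simp: ladder_edges_def less_2_cases_iff)

lemma end_vertex_in_ringel_ladder:
  assumes "d \<in> edge_ends (ringel_ladder n)"
  shows "end_vertex (ringel_ladder n) d \<in> verts (ringel_ladder n)"
    and "d \<in> range (port_end (ringel_ends n (end_vertex (ringel_ladder n) d)))"
proof -
  let ?G = "ringel_ladder n"
  have "end_vertex ?G d \<in> verts ?G \<and> d \<in> range (port_end (ringel_ends n (end_vertex ?G d)))"
    using assms
  proof (cases rule: edge_ends_ringel_ladder_cases)
    case (1 b)
    then show ?thesis
      by (cases b) (simp_all add: end_vertex_ringel_ladder ringel_ends_def cap_ends_def
        verts_ringel_ladder ladder_verts_def range_port_end)
  next
    case (2 j b)
    then obtain j' where "j = Suc j'" by (cases j) auto
    with 2 show ?thesis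
      by (cases b) (simp_all add: end_vertex_ringel_ladder ringel_ends_def
        verts_ringel_ladder ladder_verts_def range_port_end)
  next
    case (3 i j b)
    then show ?thesis
      by (cases "i = 0"; cases b; cases j; cases "j = n")
       (simp_all add: end_vertex_ringel_ladder ringel_ends_def cap_ends_def
        verts_ringel_ladder ladder_verts_def range_port_end less_2_cases_iff)
  qed
  then show "end_vertex ?G d \<in> verts ?G" "d \<in> range (port_end (ringel_ends n (end_vertex ?G d)))"
    by auto
qed

lemma ringel_ladder_vertex_cases:
  assumes "v \<in> verts (ringel_ladder n)"
  obtains "v = (0, 0)" | "v = (0, Suc n)"
    | j where "v = (0, Suc j)" "j < n" | j where "v = (1, Suc j)" "j < n"
  using assms that
proof (cases v)
  case (Pair i j)
  with assms that show ?thesis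
    by (cases j) (auto simp: verts_ringel_ladder ladder_verts_def Suc_le_eq)
qed

lemma edge_ends_at_ringel_ladder:
  assumes v: "v \<in> verts (ringel_ladder n)"
  shows "edge_ends_at (ringel_ladder n) v = range (port_end (ringel_ends n v))"
proof
  show "edge_ends_at (ringel_ladder n) v \<subseteq> range (port_end (ringel_ends n v))"
    using end_vertex_in_ringel_ladder(2) by (auto simp only: edge_ends_at_def mem_Collect_eq)
  show "range (port_end (ringel_ends n v)) \<subseteq> edge_ends_at (ringel_ladder n) v"
    using v
    by (cases rule: ringel_ladder_vertex_cases)
       (simp_all add: ringel_ends_def cap_ends_def range_port_end edge_ends_at_def edge_ends_def
          arcs_ringel_ladder end_vertex_ringel_ladder)
qed

lemma inj_ringel_ends:
  assumes "v \<in> verts (ringel_ladder n)"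
  shows "inj (port_end (ringel_ends n v))"
proof (rule injI)
  fix p p' assume "port_end (ringel_ends n v) p = port_end (ringel_ends n v) p'"
  with assms show "p = p'"
    by (cases rule: ringel_ladder_vertex_cases; cases p; cases p')
       (simp_all add: ringel_ends_def cap_ends_def)
qed

lemmas ringel_ladder_cubic =
  edge_ends_at_ringel_ladder inj_ringel_ends end_vertex_in_ringel_ladder(1)

lemma card_verts_ringel_ladder: "card (verts (ringel_ladder n)) = 2 * n + 2"
proof -
  have "card ({0, 1 :: nat} \<times> {1..n}) = 2 * n" by simp
  moreover have "(0, 0) \<notin> {0, 1 :: nat} \<times> {1..n}" by simp
  ultimately have "card (ladder_verts n) = 2 * n + 1"
    unfolding ladder_verts_def by (subst card_insert_disjoint) simp_all
  then show ?thesis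
    unfolding verts_ringel_ladder
    by (subst card_insert_disjoint) (simp_all add: ladder_verts_def)
qed

lemma card_arcs_ringel_ladder: "card (arcs (ringel_ladder n)) = 3 * n + 3"
proof -
  have "card (rung ` {1..n}) = n" "card (side i ` {..n}) = n + 1" for i
    by (simp_all add: card_image inj_on_def)
  moreover have "rung ` {1..n} \<inter> side 0 ` {..n} = {}"
    "(rung ` {1..n} \<union> side 0 ` {..n}) \<inter> side 1 ` {..n} = {}" by auto
  ultimately have "card (rung ` {1..n} \<union> side 0 ` {..n} \<union> side 1 ` {..n}) = 3 * n + 2"
    by (simp add: card_Un_disjoint)
  moreover have "bar \<notin> rung ` {1..n} \<union> side 0 ` {..n} \<union> side 1 ` {..n}" by auto
  ultimately show ?thesis
    unfolding arcs_ringel_ladder ladder_edges_def by (subst card_insert_disjoint) simp_all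
qed

lemma isolated_verts_ringel_ladder: "isolated_verts (ringel_ladder n) = {}"
  by (simp add: isolated_verts_def edge_ends_at_ringel_ladder)

definition ringel_genus :: "nat \<Rightarrow> (nat \<times> nat) set \<Rightarrow> nat" where
  "ringel_genus n A = ladder_genus A (Cyc ((0, Suc n) \<in> A)) n"

lemma capped_Cyc: "capped R (Cyc s) t \<longleftrightarrow> turns R s t"
  by (cases t; cases s) (auto simp: capped_alt turns_def)

lemma euler_char_ringel_ladder:
  assumes R: "rotation_system (ringel_ladder n) R"
    and A: "A = {v \<in> verts (ringel_ladder n). turns R True (ringel_ends n v)}"
  shows "euler_char (ringel_ladder n) R = 2 - 2 * int (ringel_genus n A)"
proof -
  let ?G = "ringel_ladder n"
  have R': "R permutes ladder_edges n \<times> UNIV"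
      "\<And>v. v \<in> verts ?G \<Longrightarrow> \<exists>s. turns R s (ringel_ends n v)"
    using R rotation_system_cubic_iff[OF ringel_ladder_cubic]
    by (auto simp: edge_ends_def arcs_ringel_ladder)
  have turns: "turns R (v \<in> A) (ringel_ends n v)" if "v \<in> verts ?G" for v
    using turns_own_sign[OF R'(2)[OF that]] that by (simp add: A)
  have "turns R ((0, Suc n) \<in> A) (cap_ends n)"
    using turns[of "(0, Suc n)"] by (simp add: verts_ringel_ladder ringel_ends_def)
  moreover have "turns R (v \<in> A) (corner v)" if "v \<in> ladder_verts n" for v
  proof -
    have "v \<noteq> (0, Suc n)" using that by (auto simp: ladder_verts_def)
    then show ?thesis using turns[of v] that by (simp add: verts_ringel_ladder ringel_ends_def)
  qed
  ultimately have "capped_ladder n A (Cyc ((0, Suc n) \<in> A)) R"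
    using R'(1) by (simp add: capped_ladder_def capped_Cyc)
  from num_faces_capped_ladder[OF this]
  have "num_faces (ladder_edges n) R + 2 * ringel_genus n A = n + 3"
    by (simp add: ringel_genus_def)
  moreover have "card (faces ?G R) = num_faces (ladder_edges n) R"
    using num_faces_eq[OF R'(1)] by (simp add: faces_def edge_ends_def arcs_ringel_ladder)
  ultimately show ?thesis
    by (simp add: euler_char_def card_verts_ringel_ladder card_arcs_ringel_ladder
      isolated_verts_ringel_ladder)
qed

lemma num_embeddings_ringel_ladder:
  "num_embeddings (ringel_ladder n) i =
     card {A \<in> Pow (verts (ringel_ladder n)). ringel_genus n A = i}"
proof -
  let ?G = "ringel_ladder n"
  let ?f = "\<lambda>R. {v \<in> verts ?G. turns R True (ringel_ends n v)}"
  have bij: "bij_betw ?f {R. rotation_system ?G R} (Pow (verts ?G))"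
    by (rule bij_betw_cubic_rotation_systems[OF ringel_ladder_cubic])
  have char: "euler_char ?G R = 2 - 2 * int i \<longleftrightarrow> ringel_genus n (?f R) = i"
    if "rotation_system ?G R" for R
    using euler_char_ringel_ladder[OF that refl] by auto
  have "?f ` {R. rotation_system ?G R \<and> euler_char ?G R = 2 - 2 * int i}
      = {A \<in> Pow (verts ?G). ringel_genus n A = i}" (is "?f ` ?X = ?Y")
  proof
    show "?f ` ?X \<subseteq> ?Y" using char by blast
    show "?Y \<subseteq> ?f ` ?X"
    proof
      fix A assume A: "A \<in> ?Y"
      then have "A \<in> ?f ` {R. rotation_system ?G R}" using bij_betw_imp_surj_on[OF bij] by (simp only: mem_Collect_eq)
      then obtain R where "rotation_system ?G R" "A = ?f R" by blast
      with A char[of R] show "A \<in> ?f ` ?X" by blast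
    qed
  qed
  moreover have "inj_on ?f ?X"
    using bij_betw_imp_inj_on[OF bij] by (rule inj_on_subset) blast
  ultimately have "card ?Y = card ?X" using card_image[of ?f ?X] by (simp only:)
  then show ?thesis unfolding num_embeddings_def by (rule sym)
qed

text \<open>
  Grouping the sets of positive vertices by genus gives the coefficients.
\<close>

lemma genus_polynomial_ringel_ladder:
  "genus_polynomial (ringel_ladder n) =
     (\<Sum>A \<in> Pow (verts (ringel_ladder n)). monom 1 (ringel_genus n A))"
proof -
  let ?V = "Pow (verts (ringel_ladder n))"
  have fin: "finite ?V" by (simp add: verts_ringel_ladder ladder_verts_def)
  have "genus_polynomial (ringel_ladder n) =
      Sum_any (\<lambda>i. \<Sum>A \<in> {A \<in> ?V. ringel_genus n A = i}. monom (1 :: int) (ringel_genus n A))"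
  proof -
    have "monom (int (num_embeddings (ringel_ladder n) i)) i =
        (\<Sum>A \<in> {A \<in> ?V. ringel_genus n A = i}. monom 1 (ringel_genus n A))" for i
    proof -
      have "(\<Sum>A \<in> {A \<in> ?V. ringel_genus n A = i}. monom (1 :: int) (ringel_genus n A))
          = (\<Sum>A \<in> {A \<in> ?V. ringel_genus n A = i}. monom 1 i)"
        by (rule sum.cong) auto
      also have "\<dots> = monom (int (num_embeddings (ringel_ladder n) i)) i"
        unfolding sum_constant num_embeddings_ringel_ladder of_nat_monom mult_monom by simp
      finally show ?thesis ..
    qed
    then show ?thesis by (simp only: genus_polynomial_def)
  qed
  also have "\<dots> = (\<Sum>i \<in> ringel_genus n ` ?V.
      \<Sum>A \<in> {A \<in> ?V. ringel_genus n A = i}. monom 1 (ringel_genus n A))"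
    by (rule Sum_any.expand_superset) (use fin in \<open>auto intro: ccontr\<close>)
  also have "\<dots> = (\<Sum>A \<in> ?V. monom 1 (ringel_genus n A))"
    using fin by (rule sum.image_gen[symmetric])
  finally show ?thesis .
qed

section \<open>Recurrences for the genus polynomials\<close>

lemma sum_Pow_insert:
  assumes "finite S" "v \<notin> S"
  shows "sum h (Pow (insert v S)) = (\<Sum>A \<in> Pow S. h A + h (insert v A))"
proof -
  have "inj_on (insert v) (Pow S)" using assms(2) by (auto simp: inj_on_def)
  moreover have "Pow S \<inter> insert v ` Pow S = {}" using assms(2) by auto
  ultimately show ?thesis
    using assms(1) by (simp add: Pow_insert sum.union_disjoint sum.reindex sum.distrib)
qed

lemma ladder_genus_insert:
  assumes "v \<notin> ladder_verts k"
  shows "ladder_genus (insert v A) \<beta> k = ladder_genus A \<beta> k"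
  using assms
proof (induction k arbitrary: \<beta>)
  case 0
  then show ?case by (auto simp: ladder_verts_def)
next
  case (Suc k)
  then have "v \<noteq> (0, Suc k)" "v \<noteq> (1, Suc k)" "v \<notin> ladder_verts k"
    by (auto simp: ladder_verts_Suc)
  then show ?case using Suc.IH by (simp add: Let_def)
qed

text \<open>
  The genus polynomial of the ladder with \<open>k\<close> rungs and a fixed cap.
\<close>

definition ladder_poly :: "nat \<Rightarrow> cap \<Rightarrow> int poly" where
  "ladder_poly k \<beta> = (\<Sum>A \<in> Pow (ladder_verts k). monom 1 (ladder_genus A \<beta> k))"

abbreviation X :: "int poly" where "X \<equiv> [:0, 1:]"

lemma monom_one: "monom 1 (Suc 0) = X"
  by (simp add: monom_altdef)

lemma finite_ladder_verts [simp]: "finite (ladder_verts k)"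
  by (simp add: ladder_verts_def)

lemma ladder_poly_0: "ladder_poly 0 (Cyc s) = 1 + X" "ladder_poly 0 (Fix p) = 2"
  "ladder_poly 0 Ident = 2"
proof -
  have "Pow (ladder_verts 0) = {{}, {(0, 0)}}" by (auto simp: ladder_verts_def Pow_insert)
  then show "ladder_poly 0 (Cyc s) = 1 + X" "ladder_poly 0 (Fix p) = 2" "ladder_poly 0 Ident = 2"
    by (cases s; simp add: ladder_poly_def monom_one)+
qed

text \<open>
  The signs at the last rung select the next cap and the exponent of \<open>x\<close>; the genus of the rest does not
  depend on them.
\<close>

lemma ladder_poly_Suc:
  "ladder_poly (Suc k) \<beta> = (\<Sum>p \<in> UNIV. \<Sum>q \<in> UNIV.
     monom 1 (if defect \<beta> < defect (add_rung \<beta> p q) then 1 else 0) * ladder_poly k (add_rung \<beta> p q))"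
proof -
  let ?V = "ladder_verts k" and ?w = "\<lambda>A. monom (1 :: int) (ladder_genus A \<beta> (Suc k))"
  let ?u = "(0, Suc k)" and ?v = "(1, Suc k)"
  have new: "?u \<notin> ?V" "?v \<notin> ?V" by (auto simp: ladder_verts_def)
  have genus: "?w (B \<union> A) =
      monom 1 (if defect \<beta> < defect (add_rung \<beta> p q) then 1 else 0)
        * monom 1 (ladder_genus A (add_rung \<beta> p q) k)"
    if "A \<in> Pow ?V" "B \<subseteq> {?u, ?v}" "p \<longleftrightarrow> ?u \<in> B" "q \<longleftrightarrow> ?v \<in> B" for A B p q
  proof -
    have "?u \<in> B \<union> A \<longleftrightarrow> p" "?v \<in> B \<union> A \<longleftrightarrow> q" using that new by blast+
    moreover have "ladder_genus (B \<union> A) \<beta>' k = ladder_genus A \<beta>' k" for \<beta>'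
    proof -
      have "finite B" using that(2) by (rule finite_subset) simp
      then show ?thesis using that(2)
      proof induction
        case (insert b B)
        then have "b \<notin> ladder_verts k" using new by blast
        with insert show ?case by (simp add: ladder_genus_insert)
      qed simp
    qed
    ultimately show ?thesis by (simp add: Let_def mult_monom)
  qed
  have "ladder_poly (Suc k) \<beta> =
      (\<Sum>A \<in> Pow ?V. ?w A + ?w (insert ?v A) + (?w (insert ?u A) + ?w (insert ?u (insert ?v A))))"
    unfolding ladder_poly_def ladder_verts_Suc using new
    by (simp add: sum_Pow_insert insert_commute sum.distrib)
  also have "\<dots> = (\<Sum>A \<in> Pow ?V. \<Sum>p \<in> UNIV. \<Sum>q \<in> UNIV.
      monom 1 (if defect \<beta> < defect (add_rung \<beta> p q) then 1 else 0)
        * monom 1 (ladder_genus A (add_rung \<beta> p q) k))"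
  proof (rule sum.cong[OF refl])
    fix A assume A: "A \<in> Pow ?V"
    show "?w A + ?w (insert ?v A) + (?w (insert ?u A) + ?w (insert ?u (insert ?v A))) =
      (\<Sum>p \<in> UNIV. \<Sum>q \<in> UNIV. monom 1 (if defect \<beta> < defect (add_rung \<beta> p q) then 1 else 0)
        * monom 1 (ladder_genus A (add_rung \<beta> p q) k))"
      using genus[OF A, of "{}" False False] genus[OF A, of "{?v}" False True]
        genus[OF A, of "{?u}" True False] genus[OF A, of "{?u, ?v}" True True]
      by (simp add: UNIV_bool del: ladder_genus.simps)
  qed
  also have "\<dots> = (\<Sum>p \<in> UNIV. \<Sum>q \<in> UNIV. \<Sum>A \<in> Pow ?V.
      monom 1 (if defect \<beta> < defect (add_rung \<beta> p q) then 1 else 0)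
        * monom 1 (ladder_genus A (add_rung \<beta> p q) k))"
    by (simp only: UNIV_bool sum.distrib sum.insert sum.empty finite.intros insert_iff empty_iff
      simp_thms add_0_right)
  finally show ?thesis by (simp only: ladder_poly_def sum_distrib_left)
qed

lemma ladder_poly_rec:
  "ladder_poly (Suc k) (Cyc s) = ladder_poly k (Cyc s)
     + X * (ladder_poly k (Fix Top) + ladder_poly k (Fix Bot) + ladder_poly k (Fix Bar))"
  "ladder_poly (Suc k) (Fix Top) = 2 * (ladder_poly k (Cyc True) + ladder_poly k (Cyc False))"
  "ladder_poly (Suc k) (Fix Bot) = 2 * (ladder_poly k (Cyc True) + ladder_poly k (Cyc False))"
  "ladder_poly (Suc k) (Fix Bar) = 2 * X * ladder_poly k Ident + 2 * ladder_poly k (Fix Bar)"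
  "ladder_poly (Suc k) Ident = 4 * ladder_poly k (Fix Bar)"
  by (cases s; simp add: ladder_poly_Suc UNIV_bool monom_one algebra_simps)+

section \<open>Closed form\<close>

text \<open>
  The polynomials \<open>S\<^sub>n(z)\<close> of the introduction.  Each is the sum of two consecutive Fibonacci
  polynomials.
\<close>

fun fib_pair_poly :: "'a :: comm_ring_1 \<Rightarrow> nat \<Rightarrow> 'a" where
  "fib_pair_poly z 0 = 2"
| "fib_pair_poly z (Suc 0) = 2 + z"
| "fib_pair_poly z (Suc (Suc n)) = fib_pair_poly z (Suc n) + z * fib_pair_poly z n"

lemma ladder_poly_Fix_Bar: "ladder_poly k (Fix Bar) = 2 ^ k * fib_pair_poly (2 * X) k"
proof (induction k rule: induct_nat_012)
  case 0
  then show ?case by (simp add: ladder_poly_0)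
next
  case 1
  then show ?case by (simp add: ladder_poly_0 ladder_poly_rec algebra_simps)
next
  case (ge2 k)
  have "ladder_poly (Suc (Suc k)) (Fix Bar) =
      8 * X * ladder_poly k (Fix Bar) + 2 * ladder_poly (Suc k) (Fix Bar)"
    by (simp only: ladder_poly_rec(4)[of "Suc k"] ladder_poly_rec(5))
  also have "\<dots> = 2 ^ Suc (Suc k) * fib_pair_poly (2 * X) (Suc (Suc k))"
    unfolding ge2.IH fib_pair_poly.simps power_Suc by algebra
  finally show ?case .
qed

lemma ladder_poly_Cyc:
  "2 * ladder_poly k (Cyc s) =
     (1 - X) * fib_pair_poly (8 * X) k + 2 * X * (2 ^ k * fib_pair_poly (2 * X) k)"
proof (induction k arbitrary: s rule: induct_nat_012)
  case 0
  then show ?case by (simp add: ladder_poly_0 algebra_simps)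
next
  case 1
  then show ?case by (simp add: ladder_poly_0 ladder_poly_rec algebra_simps)
next
  case (ge2 k)
  have "2 * ladder_poly (Suc (Suc k)) (Cyc s) = 2 * ladder_poly (Suc k) (Cyc s)
      + 2 * X * ladder_poly (Suc k) (Fix Bar)
      + 4 * X * (2 * ladder_poly k (Cyc True) + 2 * ladder_poly k (Cyc False))"
    by (simp only: ladder_poly_rec(1)[of "Suc k"] ladder_poly_rec(2,3)) algebra
  also have "\<dots> = (1 - X) * fib_pair_poly (8 * X) (Suc (Suc k))
      + 2 * X * (2 ^ Suc (Suc k) * fib_pair_poly (2 * X) (Suc (Suc k)))"
    unfolding ge2.IH ladder_poly_Fix_Bar fib_pair_poly.simps power_Suc by algebra
  finally show ?case .
qed

lemma genus_polynomial_ringel_ladder_caps: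
  "genus_polynomial (ringel_ladder n) = ladder_poly n (Cyc True) + ladder_poly n (Cyc False)"
proof -
  have v: "(0, Suc n) \<notin> ladder_verts n" by (auto simp: ladder_verts_def)
  have "monom 1 (ringel_genus n A) + monom 1 (ringel_genus n (insert (0, Suc n) A))
      = (monom 1 (ladder_genus A (Cyc False) n) + monom 1 (ladder_genus A (Cyc True) n) :: int poly)"
    if "A \<in> Pow (ladder_verts n)" for A
  proof -
    have "(0, Suc n) \<notin> A" using v that by auto
    then show ?thesis by (simp add: ringel_genus_def ladder_genus_insert[OF v])
  qed
  then show ?thesis
    unfolding genus_polynomial_ringel_ladder verts_ringel_ladder
      sum_Pow_insert[OF finite_ladder_verts v] ladder_poly_def
    by (simp add: sum.distrib add.commute)
qed

text \<open>
  The diagonal sums of Pascal's triangle, as in the classical formula for the Fibonacci numbers.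
\<close>

definition fib_poly :: "'a :: comm_ring_1 \<Rightarrow> nat \<Rightarrow> 'a" where
  "fib_poly z n = (\<Sum>j\<le>n. of_nat ((n - j) choose j) * z ^ j)"

lemma fib_poly_Suc_Suc: "fib_poly z (Suc (Suc n)) = fib_poly z (Suc n) + z * fib_poly z n"
proof -
  have "fib_poly z (Suc (Suc n)) = 1 + (\<Sum>i\<le>Suc n. of_nat ((Suc n - i) choose Suc i) * z ^ Suc i)"
    unfolding fib_poly_def by (subst sum.atMost_Suc_shift) simp
  also have "(\<Sum>i\<le>Suc n. of_nat ((Suc n - i) choose Suc i) * z ^ Suc i)
      = (\<Sum>i\<le>n. of_nat ((Suc n - i) choose Suc i) * z ^ Suc i)" by simp
  also have "\<dots> = (\<Sum>i\<le>n. of_nat ((n - i) choose Suc i) * z ^ Suc i + z * (of_nat ((n - i) choose i) * z ^ i))"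
    by (rule sum.cong) (simp_all add: Suc_diff_le algebra_simps)
  also have "\<dots> = (\<Sum>i\<le>n. of_nat ((n - i) choose Suc i) * z ^ Suc i) + z * fib_poly z n"
    by (simp add: fib_poly_def sum.distrib sum_distrib_left)
  also have "1 + ((\<Sum>i\<le>n. of_nat ((n - i) choose Suc i) * z ^ Suc i) + z * fib_poly z n)
      = fib_poly z (Suc n) + z * fib_poly z n"
    unfolding fib_poly_def[of z "Suc n"] by (subst sum.atMost_Suc_shift) simp
  finally show ?thesis .
qed

lemma fib_poly_add: "fib_poly z n + fib_poly z (Suc n) = fib_pair_poly z n"
proof (induction n rule: induct_nat_012)
  case (ge2 n)
  then show ?case
    by (simp add: fib_poly_Suc_Suc[of z n] fib_poly_Suc_Suc[of z "Suc n"] algebra_simps flip: ge2.IH)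
qed (simp_all add: fib_poly_def numeral_2_eq_2)

lemma binom_diff: "binom (int n - int j) (int j) = (if j \<le> n then int ((n - j) choose j) else 0)"
proof (cases "j \<le> n")
  case True
  then have eq: "int n - int j = int (n - j)" by simp
  show ?thesis unfolding eq by (simp add: binom_def binomial_eq_0 True del: of_nat_diff)
next
  case False
  then show ?thesis by (simp add: binom_def)
qed

text \<open>
  The two families of binomial coefficients are diagonals of Pascal's triangle, of index \<open>n\<close> and \<open>n + 1\<close>.
\<close>

lemma Sum_any_binom:
  fixes z :: "'a :: {comm_ring_1, ring_char_0}"
  shows "Sum_any (\<lambda>j. of_int (binom (int n - int j) (int j) + binom (int n - int j + 1) (int j)) * z ^ j)
    = fib_pair_poly z n"
proof -
  let ?c = "\<lambda>n j. binom (int n - int j) (int j)"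
  have shift: "int n - int j + 1 = int (Suc n) - int j" for j by simp
  have fib: "(\<Sum>j\<le>Suc n. of_int (?c m j) * z ^ j) = fib_poly z m" if "m = n \<or> m = Suc n" for m
    unfolding fib_poly_def
    by (rule sum.mono_neutral_cong_right) (use that in \<open>auto simp: binom_diff\<close>)
  have "Sum_any (\<lambda>j. of_int (?c n j + ?c (Suc n) j) * z ^ j)
      = (\<Sum>j\<le>Suc n. of_int (?c n j + ?c (Suc n) j) * z ^ j)"
  proof (rule Sum_any.expand_superset)
    have c: "?c n j = 0" "?c (Suc n) j = 0" if "\<not> j \<le> Suc n" for j
      unfolding binom_diff using that by simp_all
    then have "of_int (?c n j + ?c (Suc n) j) * z ^ j = 0" if "\<not> j \<le> Suc n" for j
      unfolding c[OF that] by simp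
    then show "{j. of_int (?c n j + ?c (Suc n) j) * z ^ j \<noteq> 0} \<subseteq> {..Suc n}" by blast
  qed simp
  also have "\<dots> = fib_poly z n + fib_poly z (Suc n)"
    using fib[of n] fib[of "Suc n"] by (simp only: of_int_add distrib_right sum.distrib simp_thms)
  finally show ?thesis by (simp only: shift fib_poly_add)
qed

theorem theorem5p2:
  fixes n :: nat
  shows "genus_polynomial (ringel_ladder n) =
    (let x = [:0, 1:] :: int poly;
         c = (\<lambda>j::nat. of_int (binom (int n - int j) (int j) + binom (int n - int j + 1) (int j)))
     in (1 - x) * Sum_any (\<lambda>j. c j * (8 * x) ^ j)
        + x * 2 ^ (n + 1) * Sum_any (\<lambda>j. c j * (2 * x) ^ j))"
proof -
  let ?U = "fib_pair_poly (8 * X) n" and ?V = "fib_pair_poly (2 * X) n"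
  have cancel: "2 * p = 2 * q \<Longrightarrow> p = q" for p q :: "int poly" by simp
  have pow: "2 * x * (2 ^ n * y) = x * 2 ^ (n + 1) * y" for x y :: "int poly"
    by (simp only: power_add power_one_right)
  have "2 * genus_polynomial (ringel_ladder n) = 2 * ((1 - X) * ?U + 2 * X * (2 ^ n * ?V))"
    unfolding genus_polynomial_ringel_ladder_caps distrib_left[of 2 "ladder_poly n (Cyc True)"]
      ladder_poly_Cyc by (rule mult_2[symmetric])
  then have "genus_polynomial (ringel_ladder n) = (1 - X) * ?U + 2 * X * (2 ^ n * ?V)"
    by (rule cancel)
  then show ?thesis unfolding Let_def Sum_any_binom pow .
qed

end
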